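(* Let $g$ be an entire function with $g(0)\neq 0$ having at least one zero, let $r_0=\min\{|a| : a\in\mathbb{C},\ g(a)=0\}$, and let $\{p_n(x)\}$ be the Appell polynomials of $g$, defined by $\frac{e^{xt}}{g(t)}=\sum_{n=0}^\infty p_n(x)t^n$. Let $K$ be any compact subset of the region $\{x\in\mathbb{C} : |x|>1/r_0\}$. Then \[ \frac{p_n(nx)}{(xe)^n/\sqrt{2\pi n}}=\frac{1}{g(1/x)}\left(1+O(1/n)\right)\quad (n\to\infty), \] where the $O(1/n)$ term holds uniformly for $x\in K$.
   Context: Appell polynomials $p_n$ are defined from $g$ by the generating function above. $r_0$ is the smallest modulus of a zero of $g$. *)

theory Defs
  imports "HOL-Complex_Analysis.Complex_Analysis" "HOL-Computational_Algebra.Polynomial"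
begin

text \<open>
  The generating function identity is read as convergence for all \<open>t\<close> near \<open>0\<close>; the
  neighbourhood may depend on \<open>x\<close>.  For \<open>g\<close> entire with \<open>g 0 \<noteq> 0\<close> this determines
  the sequence \<open>p\<close> uniquely, see \<open>ex1_appell_polynomials\<close> below.
\<close>

definition appell_polynomials :: "(complex \<Rightarrow> complex) \<Rightarrow> (nat \<Rightarrow> complex poly) \<Rightarrow> bool" where
  "appell_polynomials g p \<longleftrightarrow>
     (\<forall>x. \<forall>\<^sub>F t in nhds 0. (\<lambda>n. poly (p n) x * t ^ n) sums (exp (x * t) / g t))"

lemma ex_appell_polynomials:
  assumes g: "g holomorphic_on UNIV" and g0: "g 0 \<noteq> 0"
  shows "\<exists>p. appell_polynomials g p"
proof -
  have "isCont g 0"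
    using g holomorphic_on_imp_continuous_on continuous_on_eq_continuous_at open_UNIV by blast
  then obtain r where r: "r > 0" "\<And>t. dist 0 t < r \<Longrightarrow> g t \<noteq> 0"
    using continuous_at_avoid[of 0 g 0] g0 by auto
  define h where "h = (\<lambda>t. 1 / g t)"
  have "h holomorphic_on ball 0 r"
    unfolding h_def using r(2)
    by (intro holomorphic_intros holomorphic_on_subset[OF g]) (auto simp: dist_commute)
  then have h: "(\<lambda>n. (deriv ^^ n) h 0 / fact n * t ^ n) sums h t" if "norm t < r" for t
    using holomorphic_power_series[of h 0 r t] that by simp
  define a where "a = (\<lambda>n. (deriv ^^ n) h 0 / fact n)"
  define p where "p = (\<lambda>n. \<Sum>k\<le>n. monom (a (n - k) / fact k) k)"
  have "(\<lambda>n. poly (p n) x * t ^ n) sums (exp (x * t) / g t)" if t: "norm t < r" for x t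
  proof -
    obtain s where s: "norm t < s" "s < r" using t dense by blast
    have s': "norm (complex_of_real s) = s" using le_less_trans[OF norm_ge_zero s(1)] by simp
    have "summable (\<lambda>n. a n * complex_of_real s ^ n)"
      using h[of "complex_of_real s"] s s' by (auto simp: a_def sums_iff)
    then have 1: "summable (\<lambda>n. norm (a n * t ^ n))"
      using powser_insidea[of a "complex_of_real s" t] s s' by simp
    have 2: "summable (\<lambda>n. norm ((x * t) ^ n /\<^sub>R fact n))"
      by (rule summable_norm_exp)
    have "(\<lambda>n. \<Sum>k\<le>n. ((x * t) ^ k /\<^sub>R fact k) * (a (n - k) * t ^ (n - k))) sums
        ((\<Sum>k. (x * t) ^ k /\<^sub>R fact k) * (\<Sum>k. a k * t ^ k))"
      by (rule Cauchy_product_sums[OF 2 1])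
    also have "(\<Sum>k. (x * t) ^ k /\<^sub>R fact k) = exp (x * t)"
      by (simp add: exp_def)
    also have "(\<Sum>k. a k * t ^ k) = h t"
      using h[OF t] by (simp add: a_def sums_iff)
    also have "(\<lambda>n. \<Sum>k\<le>n. ((x * t) ^ k /\<^sub>R fact k) * (a (n - k) * t ^ (n - k))) =
        (\<lambda>n. poly (p n) x * t ^ n)"
    proof
      fix n
      have "((x * t) ^ k /\<^sub>R fact k) * (a (n - k) * t ^ (n - k)) =
          poly (monom (a (n - k) / fact k) k) x * t ^ n" if "k \<le> n" for k
      proof -
        have "t ^ n = t ^ k * t ^ (n - k)"
          using that by (simp flip: power_add)
        then show ?thesis
          by (simp add: poly_monom scaleR_conv_of_real power_mult_distrib field_simps)
      qed
      then show "(\<Sum>k\<le>n. ((x * t) ^ k /\<^sub>R fact k) * (a (n - k) * t ^ (n - k))) =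
          poly (p n) x * t ^ n"
        by (simp add: p_def poly_sum sum_distrib_right)
    qed
    finally show ?thesis by (simp add: h_def)
  qed
  then have "appell_polynomials g p"
    unfolding appell_polynomials_def eventually_nhds_metric using r(1) by auto
  then show ?thesis by blast
qed

lemma appell_polynomials_unique:
  assumes "appell_polynomials g p" "appell_polynomials g q"
  shows "p = q"
proof
  fix n
  have "poly (p n) x = poly (q n) x" for x
  proof -
    have "(\<lambda>t. exp (x * t) / g t) has_fps_expansion Abs_fps (\<lambda>n. poly (p n) x)"
      "(\<lambda>t. exp (x * t) / g t) has_fps_expansion Abs_fps (\<lambda>n. poly (q n) x)"
      using assms by (auto simp: appell_polynomials_def intro!: has_fps_expansionI)
    then have "Abs_fps (\<lambda>n. poly (p n) x) = Abs_fps (\<lambda>n. poly (q n) x)"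
      by (rule fps_expansion_unique_complex)
    then show ?thesis by (simp add: fps_eq_iff)
  qed
  then show "p n = q n" by (simp add: poly_eq_poly_eq_iff[symmetric] fun_eq_iff)
qed

lemma ex1_appell_polynomials:
  assumes "g holomorphic_on UNIV" and "g 0 \<noteq> 0"
  shows "\<exists>!p. appell_polynomials g p"
  using ex_appell_polynomials[OF assms] appell_polynomials_unique by blast

end

theory Submission
  imports Defs
begin

text \<open>
  Let \<open>1 / g t = (\<Sum>j. a j * t ^ j)\<close> for \<open>|t| < r0\<close>. Comparing coefficients in the generating
  function gives \<open>p n (n x) = (n x) ^ n / n! * (\<Sum>j\<le>n. a j * w n j * x ^ (-j))\<close> with
  \<open>w n j = n! / ((n - j)! * n ^ j) = (\<Prod>i<j. 1 - i / n)\<close>. Since \<open>0 \<le> 1 - w n j \<le> j\<^sup>2 / n\<close> and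
  \<open>(\<Sum>j. j\<^sup>2 * |a j| * s ^ j)\<close> converges for \<open>s < r0\<close>, the sum is \<open>1 / g (1 / x) + O(1 / n)\<close>
  uniformly for \<open>|x| \<ge> 1 / s\<close>. The factor in front is handled by Stirling's formula with error
  term \<open>O(1 / n)\<close>, where Wallis' product identifies the constant.
\<close>

section \<open>Stirling's formula with an error term\<close>

text \<open>The logarithm of \<open>fact n\<close> divided by n^(n + 1/2) * exp (-n); Stirling's
  formula says that it tends to \<open>ln (2 * pi) / 2\<close>.\<close>

definition stirling_log :: "nat \<Rightarrow> real" where
  "stirling_log n = ln (fact n) - (real n + 1/2) * ln (real n) + real n"

lemma stirling_log_diff:
  assumes "n > 0"
  shows "stirling_log n - stirling_log (Suc n) = (real n + 1/2) * (ln (real n + 1) - ln (real n)) - 1"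
proof -
  have "ln (fact (Suc n) :: real) = ln (real n + 1) + ln (fact n)"
    by (simp add: ln_mult add.commute)
  then show ?thesis
    by (simp add: stirling_log_def algebra_simps)
qed

text \<open>The integral of the convex function 1/t over [n, n + 1] is at least its midpoint value 2
  / (2n + 1).\<close>

lemma stirling_log_antimono:
  assumes "n > 0"
  shows "stirling_log (Suc n) \<le> stirling_log n"
proof -
  have "2 / (2 * real n + 1) \<le> ln (real n + 1) - ln (real n)"
    using ln_inverse_approx_ge[of "real n" "real n + 1"] assms by (simp add: add_ac)
  then have "1 \<le> (real n + 1/2) * (ln (real n + 1) - ln (real n))"
    by (simp add: field_simps)
  with stirling_log_diff[OF assms] show ?thesis by linarith
qed

text \<open>The trapezoidal rule bounds the same integral from above by (1/n + 1/(n + 1)) / 2. After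
  multiplication by n + 1/2 the excess over 1 is 1 / (4n(n + 1)), which telescopes; this is where
  the correction 1 / (4n) comes from.\<close>

lemma stirling_log_mono_corrected:
  assumes "n > 0"
  shows "stirling_log n - 1 / (4 * real n) \<le> stirling_log (Suc n) - 1 / (4 * real (Suc n))"
proof -
  have "ln (real n + 1) - ln (real n) \<le> (2 * real n + 1) / (2 * real n * (real n + 1))"
    using ln_inverse_approx_le[of "real n" 1] assms by (simp add: field_simps)
  then have "(real n + 1/2) * (ln (real n + 1) - ln (real n)) \<le>
      (real n + 1/2) * ((2 * real n + 1) / (2 * real n * (real n + 1)))"
    by (intro mult_left_mono) auto
  also have "\<dots> = 1 + (1 / (4 * real n) - 1 / (4 * real (Suc n)))"
    using assms by (simp add: divide_simps) (simp add: algebra_simps)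
  finally show ?thesis
    using stirling_log_diff[OF assms] by linarith
qed

text \<open>The factorial form of the partial Wallis products is what links them to
  \<open>stirling_log\<close>.\<close>

lemma wallis_product_eq:
  "(\<Prod>k=1..n. (4 * real k ^ 2) / (4 * real k ^ 2 - 1)) =
     2 ^ (4 * n) * fact n ^ 4 / (fact (2 * n) ^ 2 * (2 * real n + 1))"
proof (induction n)
  case (Suc n)
  have fact_double: "(fact (2 * Suc n) :: real) = (2 * real n + 2) * (2 * real n + 1) * fact (2 * n)"
    by (simp add: algebra_simps)
  have "4 * real (Suc n) ^ 2 - 1 = (2 * real n + 1) * (2 * real n + 3)"
    by (simp add: power2_eq_square algebra_simps)
  then have "(\<Prod>k=1..Suc n. (4 * real k ^ 2) / (4 * real k ^ 2 - 1)) =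
      2 ^ (4 * n) * fact n ^ 4 / (fact (2 * n) ^ 2 * (2 * real n + 1)) *
      ((4 * (real n + 1) ^ 2) / ((2 * real n + 1) * (2 * real n + 3)))"
    using Suc by (simp add: add.commute)
  also have "\<dots> = 2 ^ (4 * Suc n) * fact (Suc n) ^ 4 /
      (fact (2 * Suc n) ^ 2 * (2 * real (Suc n) + 1))"
  proof -
    \<comment> \<open>With factorials and powers replaced by variables this is an identity of
      rational functions; it is used with m = n + 1, u = 2n + 1, v = 2n + 3.\<close>
    have e: "A * F ^ 4 / (G\<^sup>2 * u) * (4 * m\<^sup>2 / (u * v)) =
        (16 * A) * (m * F) ^ 4 / (((2 * m) * u * G)\<^sup>2 * v)"
      if "m \<noteq> 0" "u \<noteq> 0" "v \<noteq> 0" "G \<noteq> 0" for A F G m u v :: real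
      unfolding times_divide_times_eq
      by (subst frac_eq_eq) (use that in \<open>simp_all, algebra\<close>)
    show ?thesis
      unfolding fact_double
      using e[of "real n + 1" "2 * real n + 1" "2 * real n + 3" "fact (2 * n)" "2 ^ (4 * n)" "fact n"]
      by (simp add: algebra_simps power_add)
  qed
  finally show ?case .
qed simp

text \<open>In this combination the terms in n and in n * ln n cancel. If
  \<open>stirling_log\<close> tends to L, the left side tends to 2L, so Wallis' product determines
  L.\<close>

lemma stirling_log_wallis:
  assumes "n > 0"
  shows "4 * stirling_log n - 2 * stirling_log (2 * n) =
    ln (\<Prod>k=1..n. (4 * real k ^ 2) / (4 * real k ^ 2 - 1)) + ln (2 * (2 * real n + 1) / real n)"
proof -
  have "ln (\<Prod>k=1..n. (4 * real k ^ 2) / (4 * real k ^ 2 - 1)) =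
      4 * real n * ln 2 + 4 * ln (fact n) - (2 * ln (fact (2 * n)) + ln (2 * real n + 1))"
    unfolding wallis_product_eq
    by (simp add: ln_mult ln_div ln_realpow)
  moreover have "ln (2 * (2 * real n + 1) / real n) = ln 2 + ln (2 * real n + 1) - ln (real n)"
    using assms by (simp add: ln_mult ln_div del: distrib_left_numeral)
  moreover have "ln (real (2 * n)) = ln 2 + ln (real n)"
    using assms by (simp add: ln_mult)
  ultimately show ?thesis
    by (simp add: stirling_log_def algebra_simps)
qed

lemma stirling_log_LIMSEQ: "stirling_log \<longlonglongrightarrow> ln (2 * pi) / 2"
proof -
  let ?d = "\<lambda>n. stirling_log (Suc n)"
  have dec: "decseq ?d"
    by (intro decseq_SucI stirling_log_antimono) simp
  have inc: "incseq (\<lambda>n. ?d n - 1 / (4 * real (Suc n)))"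
    by (intro incseq_SucI stirling_log_mono_corrected) simp
  \<comment> \<open>The lower bound is the first value, 1 - 1/4, of the increasing corrected
    sequence.\<close>
  have "3 / 4 \<le> ?d n" for n
  proof -
    have "3 / 4 = ?d 0 - 1 / (4 * real (Suc 0))" by (simp add: stirling_log_def)
    also have "\<dots> \<le> ?d n - 1 / (4 * real (Suc n))"
      using incseqD[OF inc, of 0 n] by simp
    also have "\<dots> \<le> ?d n" by simp
    finally show ?thesis .
  qed
  then obtain L where "?d \<longlonglongrightarrow> L"
    using decseq_convergent[OF dec, of "3/4"] by blast
  then have L: "stirling_log \<longlonglongrightarrow> L"
    by (rule LIMSEQ_imp_Suc)
  then have "(\<lambda>n. stirling_log (2 * n)) \<longlonglongrightarrow> L"
    by (rule filterlim_compose) (auto intro!: filterlim_subseq simp: strict_mono_def)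
  with L have lim1: "(\<lambda>n. 4 * stirling_log n - 2 * stirling_log (2 * n)) \<longlonglongrightarrow> 4 * L - 2 * L"
    by (intro tendsto_intros)
  have "(\<lambda>n. 4 + 2 * (1 / real n)) \<longlonglongrightarrow> 4 + 2 * 0"
    by (intro tendsto_intros lim_1_over_n)
  then have "(\<lambda>n. ln (4 + 2 * (1 / real n))) \<longlonglongrightarrow> ln 4"
    by (intro tendsto_ln) auto
  moreover have "\<forall>\<^sub>F n in sequentially. ln (4 + 2 * (1 / real n)) = ln (2 * (2 * real n + 1) / real n)"
    using eventually_gt_at_top[of 0] by eventually_elim (simp add: field_simps)
  ultimately have "(\<lambda>n. ln (2 * (2 * real n + 1) / real n)) \<longlonglongrightarrow> ln 4"
    by (rule Lim_transform_eventually)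
  then have "(\<lambda>n. ln (\<Prod>k=1..n. (4 * real k ^ 2) / (4 * real k ^ 2 - 1)) +
      ln (2 * (2 * real n + 1) / real n)) \<longlonglongrightarrow> ln (pi / 2) + ln 4"
    by (intro tendsto_add tendsto_ln[OF wallis]) auto
  moreover have "\<forall>\<^sub>F n in sequentially. ln (\<Prod>k=1..n. (4 * real k ^ 2) / (4 * real k ^ 2 - 1)) +
      ln (2 * (2 * real n + 1) / real n) = 4 * stirling_log n - 2 * stirling_log (2 * n)"
    using eventually_gt_at_top[of 0] by eventually_elim (simp only: stirling_log_wallis)
  ultimately have "(\<lambda>n. 4 * stirling_log n - 2 * stirling_log (2 * n)) \<longlonglongrightarrow> ln (pi / 2) + ln 4"
    by (rule Lim_transform_eventually)
  with lim1 have "4 * L - 2 * L = ln (pi / 2) + ln 4"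
    by (rule LIMSEQ_unique)
  also have "\<dots> = ln (pi / 2 * 4)"
    by (subst ln_mult) auto
  finally have "L = ln (2 * pi) / 2"
    by (simp add: mult.commute)
  with L show ?thesis by simp
qed

text \<open>The limit lies below every term of the decreasing sequence and above every term of the
  increasing corrected one.\<close>

lemma stirling_log_bounds:
  assumes "n > 0"
  shows "ln (2 * pi) / 2 \<le> stirling_log n"
    and "stirling_log n \<le> ln (2 * pi) / 2 + 1 / (4 * real n)"
proof -
  obtain m where m: "n = Suc m" using assms not0_implies_Suc by blast
  have lim: "(\<lambda>n. stirling_log (Suc n)) \<longlonglongrightarrow> ln (2 * pi) / 2"
    using stirling_log_LIMSEQ by (rule LIMSEQ_Suc)
  have "decseq (\<lambda>n. stirling_log (Suc n))"
    by (intro decseq_SucI stirling_log_antimono) simp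
  then show "ln (2 * pi) / 2 \<le> stirling_log n"
    using decseq_ge[OF _ lim, of m] m by simp
  have "(\<lambda>n. 1 / (4 * real (Suc n))) = (\<lambda>n. 1 / 4 * inverse (real (Suc n)))"
    by (simp add: inverse_eq_divide)
  moreover have "(\<lambda>n. 1 / 4 * inverse (real (Suc n))) \<longlonglongrightarrow> 1 / 4 * 0"
    by (intro tendsto_mult tendsto_const LIMSEQ_inverse_real_of_nat)
  ultimately have "(\<lambda>n. 1 / (4 * real (Suc n))) \<longlonglongrightarrow> 0"
    by simp
  then have "(\<lambda>n. stirling_log (Suc n) - 1 / (4 * real (Suc n))) \<longlonglongrightarrow> ln (2 * pi) / 2 - 0"
    by (intro tendsto_diff lim)
  moreover have "incseq (\<lambda>n. stirling_log (Suc n) - 1 / (4 * real (Suc n)))"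
    by (intro incseq_SucI stirling_log_mono_corrected) simp
  ultimately show "stirling_log n \<le> ln (2 * pi) / 2 + 1 / (4 * real n)"
    using incseq_le[of "\<lambda>n. stirling_log (Suc n) - 1 / (4 * real (Suc n))" "ln (2 * pi) / 2" m] m
    by simp
qed

text \<open>The ratio is exp y with y = \<open>ln (2 * pi) / 2 - stirling_log n\<close>, where -1 /
  (4n) \<le> y \<le> 0; the lower bound then follows from 1 + y \<le> exp y.\<close>

lemma stirling_ratio_bounds:
  assumes "n > 0"
  shows "real n ^ n * exp (- real n) * sqrt (2 * pi * real n) / fact n \<in> {1 - 1 / (4 * real n)..1}"
proof -
  have "real n ^ n * exp (- real n) * sqrt (2 * pi * real n) / fact n =
      exp (ln (real n ^ n * exp (- real n) * sqrt (2 * pi * real n) / fact n))"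
    using assms by (subst exp_ln) auto
  also have "ln (real n ^ n * exp (- real n) * sqrt (2 * pi * real n) / fact n) =
      ln (2 * pi) / 2 - stirling_log n"
  proof -
    have "ln (2 * pi * real n) = ln (2 * pi) + ln (real n)"
      using assms by (subst ln_mult) auto
    then show ?thesis
      using assms
      by (simp add: ln_mult ln_div ln_realpow ln_sqrt stirling_log_def)
        (simp add: algebra_simps add_divide_distrib)
  qed
  finally have eq: "real n ^ n * exp (- real n) * sqrt (2 * pi * real n) / fact n =
      exp (ln (2 * pi) / 2 - stirling_log n)" .
  have "1 - 1 / (4 * real n) \<le> 1 + (ln (2 * pi) / 2 - stirling_log n)"
    using stirling_log_bounds(2)[OF assms] by simp
  also have "\<dots> \<le> exp (ln (2 * pi) / 2 - stirling_log n)"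
    by (rule exp_ge_add_one_self)
  finally show ?thesis
    unfolding eq using stirling_log_bounds(1)[OF assms] by simp
qed

section \<open>The weights of the Taylor coefficients\<close>

text \<open>This is n! / ((n - j)! * n^j) for j \<le> n. The product form also covers j > n, where
  it vanishes for positive n, so that finite sums with these weights can be read as infinite
  series.\<close>

definition falling_ratio :: "nat \<Rightarrow> nat \<Rightarrow> real" where
  "falling_ratio n j = (\<Prod>i<j. 1 - real i / real n)"

lemma falling_ratio_eq_0: "n > 0 \<Longrightarrow> n < j \<Longrightarrow> falling_ratio n j = 0"
  unfolding falling_ratio_def by (rule prod_zero[OF _ bexI[of _ n]]) auto

lemma falling_ratio_fact:
  assumes "n > 0" "j \<le> n"
  shows "falling_ratio n j = fact n / (fact (n - j) * real n ^ j)"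
  using assms(2)
proof (induction j)
  case (Suc j)
  have "(fact (n - j) :: real) = real (n - j) * fact (n - Suc j)"
    using Suc.prems by (simp add: fact_reduce)
  with Suc assms(1) show ?case
    by (simp add: falling_ratio_def field_simps of_nat_diff)
qed (simp add: falling_ratio_def)

lemma falling_ratio_range:
  assumes "n > 0"
  shows "falling_ratio n j \<in> {0..1}"
proof (cases "j \<le> n")
  case True
  with assms show ?thesis
    by (auto simp: falling_ratio_def divide_simps intro!: prod_nonneg prod_le_1)
qed (use assms in \<open>simp add: falling_ratio_eq_0\<close>)

text \<open>As the ratio is at most 1, the new factor 1 - j/n lowers it by at most j/n, and j^2 + j
  \<le> (j + 1)^2.\<close>

lemma falling_ratio_lower_bound:
  assumes "n > 0"
  shows "1 - real j ^ 2 / real n \<le> falling_ratio n j"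
proof (induction j)
  case (Suc j)
  have "falling_ratio n j * (real j / real n) \<le> 1 * (real j / real n)"
    using falling_ratio_range[OF assms, of j] by (intro mult_right_mono) auto
  then have "falling_ratio n j - real j / real n \<le> falling_ratio n (Suc j)"
    by (simp add: falling_ratio_def algebra_simps)
  moreover have "real (Suc j) ^ 2 / real n \<ge> real j ^ 2 / real n + real j / real n"
    unfolding add_divide_distrib[symmetric]
    by (intro divide_right_mono) (auto simp: power2_eq_square algebra_simps)
  ultimately show ?case using Suc by linarith
qed (simp add: falling_ratio_def)

section \<open>Power series with polynomially weighted coefficients\<close>

text \<open>Termwise differentiation keeps convergence in the disc; multiplying by x restores the
  exponent.\<close>

lemma summable_times_n:
  fixes c :: "nat \<Rightarrow> 'a :: {real_normed_field, banach}"
  assumes "\<And>x. norm x < R \<Longrightarrow> summable (\<lambda>n. c n * x ^ n)" "norm x < R"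
  shows "summable (\<lambda>n. (of_nat n * c n) * x ^ n)"
proof -
  have "summable (\<lambda>n. diffs c n * x ^ n)"
    by (rule termdiff_converges[OF assms(2,1)])
  then have "summable (\<lambda>n. x * (diffs c n * x ^ n))"
    by (rule summable_mult)
  then have "summable (\<lambda>n. (of_nat (Suc n) * c (Suc n)) * x ^ Suc n)"
    by (simp add: diffs_def mult_ac)
  then show ?thesis by (subst (asm) summable_Suc_iff)
qed

lemma summable_norm_times_square:
  fixes a :: "nat \<Rightarrow> complex"
  assumes a: "\<And>t. norm t < R \<Longrightarrow> summable (\<lambda>n. a n * t ^ n)" and s: "0 \<le> s" "s < R"
  shows "summable (\<lambda>n. real n ^ 2 * norm (a n) * s ^ n)"
proof -
  have "summable (\<lambda>n. norm (a n) * x ^ n)" if x: "norm x < R" for x :: real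
  proof -
    \<comment> \<open>Convergence at a slightly larger radius gives absolute convergence at
      x.\<close>
    obtain q where q: "\<bar>x\<bar> < q" "q < R" using x dense by force
    then have "summable (\<lambda>n. a n * of_real q ^ n)" by (intro a) auto
    then have "summable (\<lambda>n. norm (a n * of_real x ^ n))"
      by (rule powser_insidea) (use q in auto)
    then show ?thesis
      by (intro summable_norm_cancel[of "\<lambda>n. norm (a n) * x ^ n"])
        (simp add: norm_mult norm_power abs_mult power_abs)
  qed
  then have "summable (\<lambda>n. (of_nat n * norm (a n)) * x ^ n)" if "norm x < R" for x :: real
    using that by (rule summable_times_n)
  then have "summable (\<lambda>n. (of_nat n * (of_nat n * norm (a n))) * s ^ n)"
    by (rule summable_times_n) (use s in auto)
  then show ?thesis by (simp add: power2_eq_square mult_ac)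
qed

section \<open>Explicit form of the Appell polynomials\<close>

text \<open>The generating function is the product of the series of 1/g and of the exponential;
  uniqueness of power series expansions allows comparing coefficients.\<close>

lemma poly_appell_polynomials:
  assumes "appell_polynomials g p" and A: "(\<lambda>t. 1 / g t) has_fps_expansion A"
  shows "poly (p n) x = (\<Sum>j\<le>n. fps_nth A j * x ^ (n - j) / fact (n - j))"
proof -
  have "(\<lambda>t. exp (x * t) / g t) has_fps_expansion Abs_fps (\<lambda>n. poly (p n) x)"
    using assms(1) by (auto simp: appell_polynomials_def intro!: has_fps_expansionI)
  moreover have "(\<lambda>t. 1 / g t * exp (x * t)) has_fps_expansion A * fps_exp x"
    by (intro has_fps_expansion_mult A has_fps_expansion_exp)
  ultimately have "Abs_fps (\<lambda>n. poly (p n) x) = A * fps_exp x"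
    by (intro fps_expansion_unique_complex) auto
  then have "poly (p n) x = fps_nth (A * fps_exp x) n"
    by (metis fps_nth_Abs_fps)
  then show ?thesis
    by (simp add: fps_mult_nth atLeast0AtMost)
qed

text \<open>Factoring (n x)^n / n! out of the coefficient formula turns the j-th term into a
  weighted term in 1/x; dividing by the normalisation leaves the Stirling ratio in front.\<close>

lemma poly_appell_polynomials_scaled:
  assumes "appell_polynomials g p" and "(\<lambda>t. 1 / g t) has_fps_expansion A" and "n > 0" "x \<noteq> 0"
  shows "poly (p n) (of_nat n * x) / ((x * exp 1) ^ n / complex_of_real (sqrt (2 * pi * real n))) =
    of_real (real n ^ n * exp (- real n) * sqrt (2 * pi * real n) / fact n) *
    (\<Sum>j. fps_nth A j * of_real (falling_ratio n j) * (1 / x) ^ j)"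
proof -
  have term_eq: "fps_nth A j * (of_nat n * x) ^ (n - j) / fact (n - j) =
      (of_nat n * x) ^ n / fact n * (fps_nth A j * of_real (falling_ratio n j) * (1 / x) ^ j)"
    if "j \<le> n" for j
  proof -
    have "(of_nat n * x) ^ n = (of_nat n * x) ^ (n - j) * (of_nat n * x) ^ j"
      using that by (simp flip: power_add)
    then show ?thesis
      using that assms(3,4) by (simp add: falling_ratio_fact power_mult_distrib field_simps)
  qed
  have "(\<Sum>j. fps_nth A j * of_real (falling_ratio n j) * (1 / x) ^ j) =
      (\<Sum>j\<le>n. fps_nth A j * of_real (falling_ratio n j) * (1 / x) ^ j)"
    by (rule suminf_finite) (use assms(3) in \<open>auto simp: falling_ratio_eq_0\<close>)
  moreover have "poly (p n) (of_nat n * x) = (of_nat n * x) ^ n / fact n *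
      (\<Sum>j\<le>n. fps_nth A j * of_real (falling_ratio n j) * (1 / x) ^ j)"
    unfolding poly_appell_polynomials[OF assms(1,2)] sum_distrib_left
    by (intro sum.cong refl term_eq) auto
  moreover have "(of_nat n * x) ^ n / fact n /
      ((x * exp 1) ^ n / complex_of_real (sqrt (2 * pi * real n))) =
      of_real (real n ^ n * exp (- real n) * sqrt (2 * pi * real n) / fact n)"
  proof -
    have "exp 1 ^ n = (exp (of_nat n) :: complex)"
      by (simp add: exp_of_nat_mult[of n 1, simplified])
    then show ?thesis
      using assms(3,4)
      by (simp add: power_mult_distrib exp_minus field_simps flip: exp_of_real)
  qed
  ultimately show ?thesis by (simp only: times_divide_eq_left[symmetric])
qed

text \<open>Termwise comparison: each weight differs from 1 by at most j^2 / n. The bound involves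
  only the radius s, hence it is uniform in z.\<close>

lemma falling_ratio_series_bound:
  fixes a :: "nat \<Rightarrow> complex"
  assumes a: "\<And>t. norm t < R \<Longrightarrow> summable (\<lambda>n. a n * t ^ n)"
    and s: "s < R" and n: "n > 0" and z: "norm z \<le> s"
  shows "norm ((\<Sum>j. a j * of_real (falling_ratio n j) * z ^ j) - (\<Sum>j. a j * z ^ j))
    \<le> (\<Sum>j. real j ^ 2 * norm (a j) * s ^ j) / real n"
proof -
  have s0: "0 \<le> s" using norm_ge_zero z by (rule order_trans)
  have bound: "norm (a j * of_real (falling_ratio n j) * z ^ j - a j * z ^ j) \<le>
      real j ^ 2 * norm (a j) * s ^ j / real n" for j
  proof -
    have "a j * of_real (falling_ratio n j) * z ^ j - a j * z ^ j =
        of_real (falling_ratio n j - 1) * (a j * z ^ j)"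
      by (simp add: algebra_simps)
    then have "norm (a j * of_real (falling_ratio n j) * z ^ j - a j * z ^ j) =
        \<bar>falling_ratio n j - 1\<bar> * (norm (a j) * norm z ^ j)"
      by (simp only: norm_mult norm_power norm_of_real)
    also have "\<dots> \<le> real j ^ 2 / real n * (norm (a j) * s ^ j)"
      using falling_ratio_lower_bound[OF n, of j] falling_ratio_range[OF n, of j] z
      by (intro mult_mono mult_left_mono power_mono) auto
    finally show ?thesis by (simp add: mult_ac)
  qed
  have sum: "summable (\<lambda>j. real j ^ 2 * norm (a j) * s ^ j)"
    using a s0 s by (rule summable_norm_times_square)
  have "summable (\<lambda>j. a j * of_real (falling_ratio n j) * z ^ j)"
    by (rule summable_finite[of "{..n}"]) (use n in \<open>auto simp: falling_ratio_eq_0\<close>)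
  then have "(\<Sum>j. a j * of_real (falling_ratio n j) * z ^ j) - (\<Sum>j. a j * z ^ j) =
      (\<Sum>j. a j * of_real (falling_ratio n j) * z ^ j - a j * z ^ j)"
    by (rule suminf_diff) (use a z s in auto)
  also have "norm \<dots> \<le> (\<Sum>j. real j ^ 2 * norm (a j) * s ^ j / real n)"
    by (rule norm_suminf_le[OF bound summable_divide[OF sum]])
  also have "\<dots> = (\<Sum>j. real j ^ 2 * norm (a j) * s ^ j) / real n"
    by (rule suminf_divide[OF sum])
  finally show ?thesis .
qed

section \<open>The smallest zero modulus and the uniform asymptotics\<close>

text \<open>The zero set is closed and nonempty, so some zero is nearest to the origin. This
  attained minimum is what gives \<open>LEAST\<close> on the reals its intended value.\<close>

lemma least_zero_modulus:
  fixes g :: "complex \<Rightarrow> complex"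
  assumes "continuous_on UNIV g" "g 0 \<noteq> 0" "\<exists>a. g a = 0"
    and r0: "r0 = (LEAST r. r \<in> {cmod a | a. g a = 0})"
  shows "r0 > 0" and "\<And>t. cmod t < r0 \<Longrightarrow> g t \<noteq> 0"
proof -
  have "closed (g -` {0})"
    using assms(1) by (intro closed_vimage) auto
  then obtain a where a: "g a = 0" "\<And>b. g b = 0 \<Longrightarrow> cmod a \<le> cmod b"
    using distance_attains_inf[of "g -` {0}" 0] assms(3) by auto
  have "r0 = cmod a"
    unfolding r0 by (rule Least_equality) (use a in auto)
  with a assms(2) show "r0 > 0" and "\<And>t. cmod t < r0 \<Longrightarrow> g t \<noteq> 0"
    by force+
qed

theorem theorem3p1:
  fixes g :: "complex \<Rightarrow> complex" and p :: "nat \<Rightarrow> complex poly"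
    and r0 :: real and K :: "complex set"
  assumes "g holomorphic_on UNIV"
    and "g 0 \<noteq> 0"
    and "\<exists>a. g a = 0"
    and "r0 = (LEAST r. r \<in> {cmod a | a. g a = 0})"
    and "appell_polynomials g p"
    and "compact K"
    and "K \<subseteq> {x. cmod x > 1 / r0}"
  shows "\<exists>(\<epsilon> :: nat \<Rightarrow> complex \<Rightarrow> complex) (C :: real).
           \<forall>\<^sub>F n in sequentially. \<forall>x\<in>K.
             poly (p n) (of_nat n * x)
                 / ((x * exp 1) ^ n / complex_of_real (sqrt (2 * pi * real n)))
               = 1 / g (1 / x) * (1 + \<epsilon> n x)
             \<and> cmod (\<epsilon> n x) \<le> C * (1 / real n)"
proof (cases "K = {}")
  case False
  have cont: "continuous_on UNIV g"
    using assms(1) by (rule holomorphic_on_imp_continuous_on)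
  note r0 = least_zero_modulus[OF cont assms(2-4)]
  \<comment> \<open>A point of K nearest to the origin makes all 1/x with x in K lie in the closed
    disc of radius s = 1/|x0|, strictly inside the disc of radius \<open>r0\<close>.\<close>
  obtain x0 where x0: "x0 \<in> K" "\<And>x. x \<in> K \<Longrightarrow> cmod x0 \<le> cmod x"
    using continuous_attains_inf[OF assms(6) False, of cmod] by (auto intro: continuous_intros)
  define s where "s = 1 / cmod x0"
  have x0_pos: "cmod x0 > 1 / r0" "1 / r0 > 0" using x0(1) assms(7) r0(1) by auto
  then have x0_nz: "cmod x0 > 0" by linarith
  have s: "s < r0"
    using x0_pos(1) x0_nz r0(1) by (simp add: s_def field_simps)
  have inv_K: "cmod (1 / x) \<le> s" "x \<noteq> 0" if "x \<in> K" for x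
    using x0(2)[OF that] x0_nz by (auto simp: s_def norm_divide intro!: divide_left_mono mult_pos_pos)
  define h where "h = (\<lambda>t. 1 / g t)"
  have h: "h holomorphic_on ball 0 r0"
    unfolding h_def using r0(2)
    by (intro holomorphic_intros holomorphic_on_subset[OF assms(1)]) auto
  define A where "A = fps_expansion h 0"
  have A: "(\<lambda>t. 1 / g t) has_fps_expansion A"
    using has_fps_expansion_fps_expansion[OF open_ball _ h] r0(1) by (simp add: A_def h_def)
  have A_sums: "(\<lambda>n. fps_nth A n * t ^ n) sums (1 / g t)" if "cmod t < r0" for t
    using holomorphic_power_series[OF h, of t] that by (simp add: A_def fps_expansion_def h_def)
  \<comment> \<open>The error term is relative to 1/g(1/x), so the additive error of the series gets
    multiplied by |g|, which needs a bound on the disc.\<close>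
  obtain B where B: "\<And>t. cmod t \<le> s \<Longrightarrow> cmod (g t) \<le> B"
  proof -
    have "bounded (g ` cball 0 s)"
      using cont by (intro compact_imp_bounded compact_continuous_image) (auto intro: continuous_on_subset)
    then obtain B where "\<forall>y \<in> g ` cball 0 s. cmod y \<le> B"
      unfolding bounded_iff by blast
    then show ?thesis by (intro that[of B]) auto
  qed
  define M where "M = (\<Sum>j. real j ^ 2 * cmod (fps_nth A j) * s ^ j)"
  \<comment> \<open>The required equation forces this choice, since g(1/x) is nonzero for x in
    K.\<close>
  define \<epsilon> where "\<epsilon> = (\<lambda>n x. g (1 / x) * (poly (p n) (of_nat n * x)
    / ((x * exp 1) ^ n / complex_of_real (sqrt (2 * pi * real n)))) - 1)"
  have "poly (p n) (of_nat n * x) / ((x * exp 1) ^ n / complex_of_real (sqrt (2 * pi * real n)))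
      = 1 / g (1 / x) * (1 + \<epsilon> n x) \<and> cmod (\<epsilon> n x) \<le> (B * M + 1) * (1 / real n)"
    if n: "n > 0" and x: "x \<in> K" for n x
  proof
    define z where "z = 1 / x"
    have z: "cmod z \<le> s" "cmod z < r0" using inv_K[OF x] s by (auto simp: z_def)
    then have gz: "g z \<noteq> 0" using r0(2) by blast
    then show "poly (p n) (of_nat n * x) / ((x * exp 1) ^ n / complex_of_real (sqrt (2 * pi * real n)))
      = 1 / g (1 / x) * (1 + \<epsilon> n x)"
      by (simp add: \<epsilon>_def z_def)
    define S where "S = real n ^ n * exp (- real n) * sqrt (2 * pi * real n) / fact n"
    define T where "T = (\<Sum>j. fps_nth A j * of_real (falling_ratio n j) * z ^ j)"
    have S: "1 - 1 / (4 * real n) \<le> S" "S \<le> 1" "0 \<le> S"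
      using stirling_ratio_bounds[OF n] by (auto simp: S_def)
    have "cmod (T - 1 / g z) \<le> M / real n"
      using falling_ratio_series_bound[of r0 "fps_nth A" s n z] A_sums z s n
      by (auto simp: T_def M_def sums_iff)
    then have "cmod (g z) * cmod (T - 1 / g z) \<le> B * (M / real n)"
      using B[OF z(1)] by (intro mult_mono) (auto intro: order_trans[OF norm_ge_zero])
    then have gT: "cmod (g z * T - 1) \<le> B * M / real n"
      using gz by (simp flip: norm_mult add: algebra_simps)
    \<comment> \<open>This separates the two sources of error: the series contributes at most B * M
      / n, Stirling's formula at most 1 / n.\<close>
    have "\<epsilon> n x = of_real S * (g z * T - 1) + of_real (S - 1)"
      unfolding \<epsilon>_def poly_appell_polynomials_scaled[OF assms(5) A n inv_K(2)[OF x]]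
        S_def[symmetric] z_def[symmetric] T_def[symmetric]
      by (simp add: algebra_simps)
    also have "cmod \<dots> \<le> cmod (of_real S * (g z * T - 1)) + cmod (of_real (S - 1))"
      by (rule norm_triangle_ineq)
    also have "\<dots> = S * cmod (g z * T - 1) + \<bar>S - 1\<bar>"
      using S(3) by (simp only: norm_mult norm_of_real abs_of_nonneg)
    also have "\<dots> \<le> 1 * (B * M / real n) + 1 / real n"
    proof (rule add_mono)
      show "S * cmod (g z * T - 1) \<le> 1 * (B * M / real n)"
        using S gT by (intro mult_mono) auto
      have "1 / (4 * real n) \<le> 1 / real n" using n by (simp add: field_simps)
      then show "\<bar>S - 1\<bar> \<le> 1 / real n" using S by linarith
    qed
    finally show "cmod (\<epsilon> n x) \<le> (B * M + 1) * (1 / real n)"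
      by (simp add: algebra_simps add_divide_distrib)
  qed
  then show ?thesis
    by (intro exI[of _ \<epsilon>] exI[of _ "B * M + 1"] eventually_mono[OF eventually_gt_at_top[of 0]]) blast
qed simp

end
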